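(* Let $R$ be a commutative noetherian ring, let $\mathfrak{a}$ be an ideal of $R$, and let $\mathcal{S}$ be a Serre subcategory of $R$-Mod. If $\mathcal{S}$ satisfies the $C_{\mathfrak{p}}$ condition for every minimal prime ideal $\mathfrak{p}$ of $\mathfrak{a}$, then $\mathcal{S}$ satisfies the $C_{\mathfrak{a}}$ condition.
   Context: $R$-Mod is the category of $R$-modules; all subcategories are full (identified with their classes of objects). A subcategory is Serre if it is closed under taking submodules, quotients and extensions. For an ideal $\mathfrak{a}$ and an $R$-module $M$, $\Gamma_{\mathfrak{a}}(M)=\{m\in M : \mathfrak{a}^k m=0 \text{ for some } k\ge 1\}$ and $(0:_M\mathfrak{a})=\{m\in M:\mathfrak{a}m=0\}$. A class $\mathcal{S}$ of $R$-modules satisfies the $C_{\mathfrak{a}}$ condition if for every $R$-module $M$: $\Gamma_{\mathfrak{a}}(M)=M$ and $(0:_M\mathfrak{a})\in\mathcal{S}$ imply $M\in\mathcal{S}$. *)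

theory Defs
  imports "HOL-Algebra.Module" "HOL-Algebra.Ideal_Product" "HOL-Algebra.Ring_Divisibility"
begin

text \<open>
  A class of \<open>R\<close>-modules is a set of module records over a carrier type \<open>'b\<close> that is an
  arbitrary type variable and plays the role of the universe.
\<close>

definition module_hom ::
  "('a, 'm) ring_scheme \<Rightarrow> ('a, 'b) module \<Rightarrow> ('a, 'c) module \<Rightarrow> ('b \<Rightarrow> 'c) set" where
  "module_hom R M N =
    {f \<in> hom (add_monoid M) (add_monoid N).
       \<forall>r \<in> carrier R. \<forall>x \<in> carrier M. f (r \<odot>\<^bsub>M\<^esub> x) = r \<odot>\<^bsub>N\<^esub> f x}"

text \<open>
  Submodules and quotients are taken up to isomorphism, as sources of injective and targets of
  surjective homomorphisms. Hence a Serre class is closed under isomorphism, and does not depend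
  on the fields \<open>mult\<close> and \<open>one\<close> that the record type \<open>module\<close> inherits from \<open>ring\<close> and that
  have no meaning for modules. A quotient formed from cosets would live in the type \<open>'b set\<close>
  rather than \<open>'b\<close>.
\<close>

definition closed_under_submodules ::
  "('a, 'm) ring_scheme \<Rightarrow> ('a, 'b) module set \<Rightarrow> bool" where
  "closed_under_submodules R S \<longleftrightarrow>
    (\<forall>L M f. module R L \<longrightarrow> M \<in> S \<longrightarrow> f \<in> module_hom R L M \<longrightarrow>
       inj_on f (carrier L) \<longrightarrow> L \<in> S)"

definition closed_under_quotients ::
  "('a, 'm) ring_scheme \<Rightarrow> ('a, 'b) module set \<Rightarrow> bool" where
  "closed_under_quotients R S \<longleftrightarrow>
    (\<forall>M N g. M \<in> S \<longrightarrow> module R N \<longrightarrow> g \<in> module_hom R M N \<longrightarrow>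
       g ` carrier M = carrier N \<longrightarrow> N \<in> S)"

definition short_exact ::
  "('a, 'm) ring_scheme \<Rightarrow> ('a, 'b) module \<Rightarrow> ('b \<Rightarrow> 'c) \<Rightarrow> ('a, 'c) module \<Rightarrow>
     ('c \<Rightarrow> 'd) \<Rightarrow> ('a, 'd) module \<Rightarrow> bool" where
  "short_exact R L f M g N \<longleftrightarrow>
    f \<in> module_hom R L M \<and> g \<in> module_hom R M N \<and>
    inj_on f (carrier L) \<and> f ` carrier L = a_kernel M N g \<and> g ` carrier M = carrier N"

definition closed_under_extensions ::
  "('a, 'm) ring_scheme \<Rightarrow> ('a, 'b) module set \<Rightarrow> bool" where
  "closed_under_extensions R S \<longleftrightarrow>
    (\<forall>L M N f g. L \<in> S \<longrightarrow> N \<in> S \<longrightarrow> module R M \<longrightarrow> short_exact R L f M g N \<longrightarrow> M \<in> S)"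

definition serre_subcategory ::
  "('a, 'm) ring_scheme \<Rightarrow> ('a, 'b) module set \<Rightarrow> bool" where
  "serre_subcategory R S \<longleftrightarrow>
    (\<forall>M \<in> S. module R M) \<and>
    closed_under_submodules R S \<and> closed_under_quotients R S \<and> closed_under_extensions R S"

text \<open>The power \<open>\<aa>\<^sup>k\<close> of an ideal is the power in the monoid of ideals \<^const>\<open>ideals_set\<close>.\<close>

definition torsion_part ::
  "('a, 'm) ring_scheme \<Rightarrow> 'a set \<Rightarrow> ('a, 'b) module \<Rightarrow> 'b set" where
  "torsion_part R \<aa> M =
    {m \<in> carrier M. \<exists>k::nat. k \<ge> 1 \<and>
       (\<forall>r \<in> \<aa> [^]\<^bsub>ideals_set R\<^esub> k. r \<odot>\<^bsub>M\<^esub> m = \<zero>\<^bsub>M\<^esub>)}"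

definition annihilated_submodule :: "'a set \<Rightarrow> ('a, 'b) module \<Rightarrow> ('a, 'b) module" where
  "annihilated_submodule \<aa> M =
    M\<lparr>carrier := {m \<in> carrier M. \<forall>r \<in> \<aa>. r \<odot>\<^bsub>M\<^esub> m = \<zero>\<^bsub>M\<^esub>}\<rparr>"

definition C_condition ::
  "('a, 'm) ring_scheme \<Rightarrow> 'a set \<Rightarrow> ('a, 'b) module set \<Rightarrow> bool" where
  "C_condition R \<aa> S \<longleftrightarrow>
    (\<forall>M. module R M \<longrightarrow> torsion_part R \<aa> M = carrier M \<longrightarrow>
       annihilated_submodule \<aa> M \<in> S \<longrightarrow> M \<in> S)"

definition minimal_prime_over :: "('a, 'm) ring_scheme \<Rightarrow> 'a set \<Rightarrow> 'a set \<Rightarrow> bool" where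
  "minimal_prime_over R \<aa> \<pp> \<longleftrightarrow>
    primeideal \<pp> R \<and> \<aa> \<subseteq> \<pp> \<and>
    (\<forall>\<qq>. primeideal \<qq> R \<longrightarrow> \<aa> \<subseteq> \<qq> \<longrightarrow> \<qq> \<subseteq> \<pp> \<longrightarrow> \<qq> = \<pp>)"

end

theory Submission
  imports Defs
begin

text \<open>
  Write \<open>(0 : I)\<close> for the submodule \<open>ann M I\<close> of a module \<open>M\<close>. In a noetherian ring, \<open>\<aa>\<close> contains
  a product \<open>\<bb>\<close> of minimal primes of \<open>\<aa>\<close>, with repetitions
  (\<open>exists_minimal_prime_product_subset\<close>). Every factor contains \<open>\<aa>\<close>, so that
  \<open>\<aa>\<^sup>k \<subseteq> \<bb> \<subseteq> \<aa>\<close> for some \<open>k\<close>. It remains to pass the \<open>C\<close> condition from the factors to their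
  product and from \<open>\<bb>\<close> to \<open>\<aa>\<close>.

  Both steps use one observation on a Serre class \<open>S\<close> (\<open>serre_submodule_by_multiplication\<close>): if
  \<open>I L \<subseteq> N\<close> with \<open>N\<close> and \<open>(0 : I)\<close> in \<open>S\<close>, then \<open>L\<close> is in \<open>S\<close>. For \<open>I\<close> is generated by finitely many
  \<open>a\<^sub>1, \<dots>, a\<^sub>n\<close>, and \<open>x \<mapsto> (a\<^sub>1 x, \<dots>, a\<^sub>n x)\<close> maps \<open>L\<close> to \<open>N\<^sup>n\<close> with kernel inside \<open>(0 : I)\<close>.

  For a product \<open>I J\<close> (\<open>C_condition_ideal_prod\<close>), let \<open>M\<close> be \<open>I J\<close>-torsion with \<open>(0 : I J)\<close> in \<open>S\<close>
  and let \<open>N\<close> be its \<open>I\<close>-torsion part. The condition for \<open>I\<close> puts \<open>N\<close> in \<open>S\<close>. The quotient \<open>M / N\<close> is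
  \<open>J\<close>-torsion, since \<open>I\<^sup>k J\<^sup>k\<close> kills \<open>m\<close> exactly if \<open>J\<^sup>k m\<close> is killed by \<open>I\<^sup>k\<close>. Its submodule
  annihilated by \<open>J\<close> is \<open>L / N\<close> with \<open>L = {m. J m \<subseteq> N}\<close>, which is in \<open>S\<close> by the observation. So the
  condition for \<open>J\<close> applies to \<open>M / N\<close>, and \<open>M\<close> is an extension of it by \<open>N\<close>.

  For the step from \<open>\<bb>\<close> to \<open>\<aa>\<close> (\<open>C_condition_larger_ideal\<close>), the inclusion
  \<open>\<aa> (0 : \<aa>\<^sup>j\<^sup>+\<^sup>1) \<subseteq> (0 : \<aa>\<^sup>j)\<close> and the observation give \<open>(0 : \<aa>\<^sup>j) \<in> S\<close> for all \<open>j\<close> by induction from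
  \<open>(0 : \<aa>) \<in> S\<close>. Hence \<open>(0 : \<bb>) \<subseteq> (0 : \<aa>\<^sup>k)\<close> is in \<open>S\<close>.

  All modules of the class share one carrier type, which may be finite. Hence the powers \<open>N\<^sup>n\<close> are
  replaced by a filtration of \<open>L\<close> by submodules, and \<open>M / N\<close> is formed on representatives of cosets.
\<close>

section \<open>Products of ideals\<close>

lemma ideal_prod_mono:
  assumes "I \<subseteq> I'" "J \<subseteq> J'"
  shows "I \<cdot>\<^bsub>R\<^esub> J \<subseteq> I' \<cdot>\<^bsub>R\<^esub> J'"
proof
  fix x assume "x \<in> I \<cdot>\<^bsub>R\<^esub> J"
  then show "x \<in> I' \<cdot>\<^bsub>R\<^esub> J'"
    by induct (use assms in \<open>auto intro: ideal_prod.intros\<close>)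
qed

lemma ideals_set_simps [simp]:
  "carrier (ideals_set R) = {I. ideal I R}"
  "I \<otimes>\<^bsub>ideals_set R\<^esub> J = I \<cdot>\<^bsub>R\<^esub> J"
  "\<one>\<^bsub>ideals_set R\<^esub> = carrier R"
  by (simp_all add: ideals_set_def)

context cring
begin

lemma ideal_pow_0: "I [^]\<^bsub>ideals_set R\<^esub> (0::nat) = carrier R"
  by simp

lemma ideal_pow_Suc: "I [^]\<^bsub>ideals_set R\<^esub> Suc k = (I [^]\<^bsub>ideals_set R\<^esub> k) \<cdot> I"
  by simp

lemma ideal_pow_ideal:
  assumes "ideal I R"
  shows "ideal (I [^]\<^bsub>ideals_set R\<^esub> (k::nat)) R"
  by (induct k) (auto simp: oneideal ideal_prod_is_ideal assms)

lemma ideal_pow_carrier: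
  assumes "ideal I R"
  shows "I [^]\<^bsub>ideals_set R\<^esub> (k::nat) \<subseteq> carrier R"
  using ideal.Icarr[OF ideal_pow_ideal[OF assms]] by blast

lemma ideal_pow_1:
  assumes "ideal I R"
  shows "I [^]\<^bsub>ideals_set R\<^esub> (1::nat) = I"
  using assms by (simp add: ideal_prod_commute[OF oneideal] ideal_prod_one)

lemma ideal_pow_mult:
  assumes "ideal I R"
  shows "(I [^]\<^bsub>ideals_set R\<^esub> (j::nat)) \<cdot> (I [^]\<^bsub>ideals_set R\<^esub> (k::nat)) = I [^]\<^bsub>ideals_set R\<^esub> (j + k)"
proof -
  interpret P: comm_monoid "ideals_set R" by (rule ideals_set_is_comm_monoid)
  show ?thesis using P.nat_pow_mult[of I j k] assms by simp
qed

lemma ideal_prod_pow: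
  assumes "ideal I R" "ideal J R"
  shows "(I \<cdot> J) [^]\<^bsub>ideals_set R\<^esub> (k::nat) = (I [^]\<^bsub>ideals_set R\<^esub> k) \<cdot> (J [^]\<^bsub>ideals_set R\<^esub> k)"
proof -
  interpret P: comm_monoid "ideals_set R" by (rule ideals_set_is_comm_monoid)
  show ?thesis using P.nat_pow_distrib[of I J k] assms by simp
qed

lemma ideal_pow_mono:
  assumes "I \<subseteq> J"
  shows "I [^]\<^bsub>ideals_set R\<^esub> (k::nat) \<subseteq> J [^]\<^bsub>ideals_set R\<^esub> k"
  by (induct k) (auto intro: ideal_prod_mono[OF _ assms, THEN subsetD])

lemma ideal_pow_antimono:
  assumes "ideal I R" "j \<le> (k::nat)"
  shows "I [^]\<^bsub>ideals_set R\<^esub> k \<subseteq> I [^]\<^bsub>ideals_set R\<^esub> j"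
proof -
  have "I [^]\<^bsub>ideals_set R\<^esub> k = (I [^]\<^bsub>ideals_set R\<^esub> j) \<cdot> (I [^]\<^bsub>ideals_set R\<^esub> (k - j))"
    using assms by (simp add: ideal_pow_mult)
  then show ?thesis
    using ideal_prod_inter[OF ideal_pow_ideal ideal_pow_ideal, OF assms(1) assms(1)] by auto
qed

end

text \<open>
  The submonoid of the monoid of ideals generated by \<open>P\<close>, given inductively so that properties
  closed under products need only be checked on \<open>P\<close>. The empty product \<open>carrier R\<close> takes care of
  the unit ideal, which has no minimal primes.
\<close>

inductive_set ideal_products :: "('a, 'm) ring_scheme \<Rightarrow> 'a set set \<Rightarrow> 'a set set"
  for R and P where
    one: "carrier R \<in> ideal_products R P"
  | factor: "I \<in> P \<Longrightarrow> I \<in> ideal_products R P"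
  | mult: "I \<in> ideal_products R P \<Longrightarrow> J \<in> ideal_products R P \<Longrightarrow> I \<cdot>\<^bsub>R\<^esub> J \<in> ideal_products R P"

lemma ideal_products_mono:
  assumes "P \<subseteq> Q"
  shows "ideal_products R P \<subseteq> ideal_products R Q"
proof
  fix I assume "I \<in> ideal_products R P"
  then show "I \<in> ideal_products R Q"
    by induct (use assms in \<open>auto intro: ideal_products.intros\<close>)
qed

context cring
begin

lemma ideal_products_ideal:
  assumes "b \<in> ideal_products R P" "\<And>I. I \<in> P \<Longrightarrow> ideal I R"
  shows "ideal b R"
  using assms by induct (auto intro: oneideal ideal_prod_is_ideal)

lemma primeideal_contains_factor:
  assumes "primeideal \<qq> R" "b \<in> ideal_products R P" "\<And>I. I \<in> P \<Longrightarrow> ideal I R" "b \<subseteq> \<qq>"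
  shows "\<exists>I\<in>P. I \<subseteq> \<qq>"
  using assms(2,4)
proof induct
  case one
  have "\<qq> \<subseteq> carrier R"
    using assms(1) by (meson ideal.Icarr primeideal.axioms(1) subsetI)
  then show ?case
    using one primeideal.I_notcarr[OF assms(1)] by blast
next
  case (mult I J)
  then show ?case
    using primeideal_divides_ideal_prod[OF assms(1), of I J] ideal_products_ideal[OF _ assms(3)]
    by blast
qed blast

text \<open>A product of \<open>k\<close> ideals that contain \<open>\<aa>\<close> contains \<open>\<aa>\<^sup>k\<close>.\<close>

lemma pow_subset_ideal_product:
  assumes "ideal \<aa> R" "b \<in> ideal_products R P" "\<And>I. I \<in> P \<Longrightarrow> \<aa> \<subseteq> I"
  shows "\<exists>k::nat. \<aa> [^]\<^bsub>ideals_set R\<^esub> k \<subseteq> b"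
  using assms(2)
proof induct
  case one
  then show ?case using ideal_pow_0 by blast
next
  case (factor I)
  then show ?case using ideal_pow_1[OF assms(1)] assms(3) by metis
next
  case (mult I J)
  then obtain j k :: nat where
    "\<aa> [^]\<^bsub>ideals_set R\<^esub> j \<subseteq> I" "\<aa> [^]\<^bsub>ideals_set R\<^esub> k \<subseteq> J" by blast
  then have "\<aa> [^]\<^bsub>ideals_set R\<^esub> (j + k) \<subseteq> I \<cdot> J"
    using ideal_prod_mono[of _ I _ J R] ideal_pow_mult[OF assms(1)] by metis
  then show ?case by blast
qed

lemma prod_of_sums_subset:
  assumes "ideal \<aa> R" "ideal I R" "ideal J R" "I \<cdot> J \<subseteq> \<aa>"
  shows "(\<aa> <+> I) \<cdot> (\<aa> <+> J) \<subseteq> \<aa>"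
proof
  interpret A: ideal \<aa> R by fact
  fix x assume "x \<in> (\<aa> <+> I) \<cdot> (\<aa> <+> J)"
  then show "x \<in> \<aa>"
  proof induct
    case (prod u v)
    obtain a i b j where u: "a \<in> \<aa>" "i \<in> I" "u = a \<oplus> i" and v: "b \<in> \<aa>" "j \<in> J" "v = b \<oplus> j"
      using prod by (auto simp: set_add_def')
    have c: "a \<in> carrier R" "b \<in> carrier R" "i \<in> carrier R" "j \<in> carrier R"
      using u v assms ideal.Icarr by metis+
    have "i \<otimes> j \<in> \<aa>"
      using u v assms(4) by (auto intro: ideal_prod.prod)
    moreover have "u \<otimes> v = a \<otimes> v \<oplus> (i \<otimes> b \<oplus> i \<otimes> j)"
      using u(3) v(3) c by (simp add: l_distr r_distr a_ac)
    ultimately show ?case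
      using u v c by (simp add: A.I_l_closed A.I_r_closed)
  qed simp
qed

end

text \<open>
  Noetherian induction. A maximal ideal \<open>M\<close> among those that violate the claim is neither the unit
  ideal nor prime, so \<open>I J \<subseteq> M\<close> for some ideals \<open>I\<close> and \<open>J\<close> not contained in \<open>M\<close>. By maximality, the
  larger ideals \<open>M + I\<close> and \<open>M + J\<close> contain products of primes, and the product of these products
  lies in \<open>(M + I) (M + J) \<subseteq> M\<close>. Finiteness of \<open>F\<close> is what gives minimal elements of \<open>F\<close> later.
\<close>

lemma exists_prime_product_subset:
  assumes "cring R" "noetherian_ring R" "ideal \<aa> R"
  shows "\<exists>F. finite F \<and> (\<forall>\<qq>\<in>F. primeideal \<qq> R \<and> \<aa> \<subseteq> \<qq>) \<and> (\<exists>b\<in>ideal_products R F. b \<subseteq> \<aa>)"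
proof (rule ccontr)
  interpret cring R by fact
  define good where "good I \<longleftrightarrow>
    (\<exists>F. finite F \<and> (\<forall>\<qq>\<in>F. primeideal \<qq> R \<and> I \<subseteq> \<qq>) \<and> (\<exists>b\<in>ideal_products R F. b \<subseteq> I))" for I
  assume "\<not> ?thesis"
  then have "\<aa> \<in> {I. ideal I R \<and> \<not> good I}"
    using assms(3) by (simp add: good_def)
  then have "\<exists>M\<in>{I. ideal I R \<and> \<not> good I}. \<forall>X\<in>{I. ideal I R \<and> \<not> good I}. M \<subseteq> X \<longrightarrow> X = M"
  proof (intro subset_Zorn_nonempty)
    fix C assume C: "C \<noteq> {}" "subset.chain {I. ideal I R \<and> \<not> good I} C"
    then have "subset.chain {I. ideal I R} C"
      by (auto simp: pred_on.chain_def)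
    then have "\<Union>C \<in> C"
      by (rule noetherian_ring.ideal_chain_is_trivial[OF assms(2) C(1)])
    then show "\<Union>C \<in> {I. ideal I R \<and> \<not> good I}"
      using C(2) by (auto simp: pred_on.chain_def)
  qed blast
  then obtain M where M: "ideal M R" "\<not> good M"
    and max: "\<And>X. ideal X R \<Longrightarrow> M \<subseteq> X \<Longrightarrow> X \<noteq> M \<Longrightarrow> good X" by blast
  have "\<not> primeideal M R"
  proof
    assume "primeideal M R"
    then have "good M"
      unfolding good_def by (intro exI[of _ "{M}"]) (auto intro: ideal_products.factor)
    with M show False by simp
  qed
  moreover have "M \<noteq> carrier R"
  proof
    assume "M = carrier R"
    then have "good M"
      unfolding good_def by (intro exI[of _ "{}"]) (auto intro: ideal_products.one)
    with M show False by simp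
  qed
  ultimately obtain I J where IJ: "ideal I R" "ideal J R" "I \<cdot>\<^bsub>R\<^esub> J \<subseteq> M" "\<not> I \<subseteq> M" "\<not> J \<subseteq> M"
    using divides_ideal_prod_imp_primeideal[OF M(1)] by blast
  have sum: "ideal (M <+>\<^bsub>R\<^esub> K) R \<and> M \<subseteq> M <+>\<^bsub>R\<^esub> K \<and> K \<subseteq> M <+>\<^bsub>R\<^esub> K" if K: "ideal K R" for K
    using union_genideal[OF M(1) K] genideal_self[of "M \<union> K"] add_ideals[OF M(1) K]
      ideal.Icarr[OF M(1)] ideal.Icarr[OF K] by blast
  have "good (M <+>\<^bsub>R\<^esub> I)" "good (M <+>\<^bsub>R\<^esub> J)"
    using max[of "M <+>\<^bsub>R\<^esub> I"] max[of "M <+>\<^bsub>R\<^esub> J"] sum IJ by blast+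
  then obtain F G b c where
    F: "finite F" "\<forall>\<qq>\<in>F. primeideal \<qq> R \<and> M <+>\<^bsub>R\<^esub> I \<subseteq> \<qq>" "b \<in> ideal_products R F" "b \<subseteq> M <+>\<^bsub>R\<^esub> I" and
    G: "finite G" "\<forall>\<qq>\<in>G. primeideal \<qq> R \<and> M <+>\<^bsub>R\<^esub> J \<subseteq> \<qq>" "c \<in> ideal_products R G" "c \<subseteq> M <+>\<^bsub>R\<^esub> J"
    unfolding good_def by blast
  have "b \<cdot>\<^bsub>R\<^esub> c \<in> ideal_products R (F \<union> G)"
    using F(3) G(3) ideal_products_mono[of F "F \<union> G" R] ideal_products_mono[of G "F \<union> G" R]
    by (blast intro: ideal_products.mult)
  moreover have "b \<cdot>\<^bsub>R\<^esub> c \<subseteq> M"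
    using ideal_prod_mono[OF F(4) G(4)] prod_of_sums_subset[OF M(1) IJ(1-3)] by blast
  moreover have "\<forall>\<qq>\<in>F \<union> G. primeideal \<qq> R \<and> M \<subseteq> \<qq>"
    using F(2) G(2) sum IJ(1,2) by blast
  ultimately have "good M"
    unfolding good_def using F(1) G(1) by (intro exI[of _ "F \<union> G"]) blast
  with M show False by simp
qed

text \<open>
  A prime ideal that contains \<open>\<aa>\<close> contains the product of primes found before, hence one of its
  factors. Therefore the inclusion-minimal factors are minimal primes of \<open>\<aa>\<close>, and replacing each
  factor by a minimal one below it only shrinks the product.
\<close>

lemma exists_minimal_prime_product_subset:
  assumes "cring R" "noetherian_ring R" "ideal \<aa> R"
  shows "\<exists>b\<in>ideal_products R {\<pp>. minimal_prime_over R \<aa> \<pp>}. b \<subseteq> \<aa>"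
proof -
  interpret cring R by fact
  obtain F b where F: "finite F" "\<And>\<qq>. \<qq> \<in> F \<Longrightarrow> primeideal \<qq> R" "\<And>\<qq>. \<qq> \<in> F \<Longrightarrow> \<aa> \<subseteq> \<qq>"
    and b: "b \<in> ideal_products R F" "b \<subseteq> \<aa>"
    using exists_prime_product_subset[OF assms] by blast
  have Fid: "ideal I R" if "I \<in> F" for I
    using F(2)[OF that] by (rule primeideal.axioms)
  have below: "\<exists>\<pp>. minimal_prime_over R \<aa> \<pp> \<and> \<pp> \<subseteq> \<qq>" if q: "\<qq> \<in> F" for \<qq>
  proof -
    obtain \<pp> where \<pp>: "\<pp> \<in> F" "\<pp> \<subseteq> \<qq>" "\<And>I. I \<in> F \<Longrightarrow> I \<subseteq> \<pp> \<Longrightarrow> I = \<pp>"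
      using finite_has_minimal2[OF F(1) q] by metis
    have "\<rr> = \<pp>" if \<rr>: "primeideal \<rr> R" "\<aa> \<subseteq> \<rr>" "\<rr> \<subseteq> \<pp>" for \<rr>
    proof -
      obtain I where "I \<in> F" "I \<subseteq> \<rr>"
        using primeideal_contains_factor[OF \<rr>(1) b(1) Fid] b(2) \<rr>(2) by blast
      then show ?thesis using \<pp>(3)[of I] \<rr>(3) by blast
    qed
    then have "minimal_prime_over R \<aa> \<pp>"
      using F \<pp>(1) by (simp add: minimal_prime_over_def)
    then show ?thesis using \<pp>(2) by blast
  qed
  have "\<exists>c\<in>ideal_products R {\<pp>. minimal_prime_over R \<aa> \<pp>}. c \<subseteq> b"
    using b(1)
  proof induct
    case one
    then show ?case using ideal_products.one by blast
  next
    case (factor I)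
    then show ?case using below[of I] by (blast intro: ideal_products.factor)
  next
    case (mult I J)
    then show ?case using ideal_prod_mono[of _ I _ J R] by (meson ideal_products.mult)
  qed
  then show ?thesis using b(2) by blast
qed

section \<open>Submodules, quotients and annihilators\<close>

lemma module_surjective_image:
  assumes "module R M" "f ` carrier M = carrier Q"
    and add: "\<And>x y. x \<in> carrier M \<Longrightarrow> y \<in> carrier M \<Longrightarrow> f x \<oplus>\<^bsub>Q\<^esub> f y = f (x \<oplus>\<^bsub>M\<^esub> y)"
    and smult: "\<And>r x. r \<in> carrier R \<Longrightarrow> x \<in> carrier M \<Longrightarrow> r \<odot>\<^bsub>Q\<^esub> f x = f (r \<odot>\<^bsub>M\<^esub> x)"
    and zero: "f \<zero>\<^bsub>M\<^esub> = \<zero>\<^bsub>Q\<^esub>"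
  shows "module R Q"
proof -
  interpret module R M by fact
  have ex: "\<exists>x\<in>carrier M. y = f x" if "y \<in> carrier Q" for y
    using that assms(2) by blast
  have cl: "f x \<in> carrier Q" if "x \<in> carrier M" for x
    using that assms(2) by blast
  show ?thesis
  proof (rule moduleI)
    show "cring R" by (rule is_cring)
    show "abelian_group Q"
    proof (rule abelian_groupI)
      fix x y assume "x \<in> carrier Q" "y \<in> carrier Q"
      then show "x \<oplus>\<^bsub>Q\<^esub> y \<in> carrier Q" "x \<oplus>\<^bsub>Q\<^esub> y = y \<oplus>\<^bsub>Q\<^esub> x"
        by (auto dest!: ex simp: add cl M.a_comm)
    next
      fix x y z assume "x \<in> carrier Q" "y \<in> carrier Q" "z \<in> carrier Q"
      then show "x \<oplus>\<^bsub>Q\<^esub> y \<oplus>\<^bsub>Q\<^esub> z = x \<oplus>\<^bsub>Q\<^esub> (y \<oplus>\<^bsub>Q\<^esub> z)"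
        by (auto dest!: ex simp: add M.a_assoc)
    next
      show "\<zero>\<^bsub>Q\<^esub> \<in> carrier Q" using cl[of "\<zero>\<^bsub>M\<^esub>"] zero by simp
    next
      fix x assume "x \<in> carrier Q"
      then obtain m where m: "m \<in> carrier M" "x = f m" using ex by blast
      then show "\<zero>\<^bsub>Q\<^esub> \<oplus>\<^bsub>Q\<^esub> x = x" by (simp add: zero[symmetric] add)
      show "\<exists>y\<in>carrier Q. y \<oplus>\<^bsub>Q\<^esub> x = \<zero>\<^bsub>Q\<^esub>"
        using m by (intro bexI[of _ "f (\<ominus>\<^bsub>M\<^esub> m)"]) (simp_all add: add cl zero[symmetric] M.l_neg)
    qed
  qed (auto dest!: ex simp: add smult cl smult_l_distr smult_r_distr smult_assoc1)
qed

lemma module_hom_add: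
  "f \<in> module_hom R M N \<Longrightarrow> x \<in> carrier M \<Longrightarrow> y \<in> carrier M \<Longrightarrow> f (x \<oplus>\<^bsub>M\<^esub> y) = f x \<oplus>\<^bsub>N\<^esub> f y"
  by (auto simp: module_hom_def hom_def)

lemma module_hom_smult:
  "f \<in> module_hom R M N \<Longrightarrow> r \<in> carrier R \<Longrightarrow> x \<in> carrier M \<Longrightarrow> f (r \<odot>\<^bsub>M\<^esub> x) = r \<odot>\<^bsub>N\<^esub> f x"
  by (auto simp: module_hom_def)

lemma submodule_zero: "submodule N R M \<Longrightarrow> \<zero>\<^bsub>M\<^esub> \<in> N"
  using subgroup.one_closed[OF submodule.axioms(1)] by force

text \<open>
  The quotient \<open>M / N\<close>, built on one chosen representative of each coset of \<open>N\<close>. Cosets themselves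
  would leave the carrier type, on which the Serre class lives.
\<close>

lemma exists_quotient:
  fixes M :: "('a, 'b) module"
  assumes M: "module R M" and N: "submodule N R M"
  shows "\<exists>(Q :: ('a, 'b) module) g. module R Q \<and> g \<in> module_hom R M Q \<and>
    g ` carrier M = carrier Q \<and> a_kernel M Q g = N"
proof -
  interpret module R M by fact
  note NE = submoduleE[OF N]
  note N0 = submodule_zero[OF N]
  \<comment> \<open>Congruent \<open>x\<close> have equivalent defining predicates, so \<open>SOME\<close> picks the same element for them.\<close>
  define rep where "rep x = (SOME y. y \<in> carrier M \<and> x \<ominus>\<^bsub>M\<^esub> y \<in> N)" for x
  have rep: "rep x \<in> carrier M" "x \<ominus>\<^bsub>M\<^esub> rep x \<in> N" if "x \<in> carrier M" for x
  proof -
    have "\<exists>y. y \<in> carrier M \<and> x \<ominus>\<^bsub>M\<^esub> y \<in> N"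
      using that N0 by (intro exI[of _ x]) (simp add: a_minus_def M.r_neg)
    then show "rep x \<in> carrier M" "x \<ominus>\<^bsub>M\<^esub> rep x \<in> N"
      unfolding rep_def by (metis (mono_tags, lifting) someI_ex)+
  qed
  have diff_trans: "x \<ominus>\<^bsub>M\<^esub> z \<in> N"
    if "x \<in> carrier M" "y \<in> carrier M" "z \<in> carrier M" "x \<ominus>\<^bsub>M\<^esub> y \<in> N" "y \<ominus>\<^bsub>M\<^esub> z \<in> N" for x y z
  proof -
    have "x \<ominus>\<^bsub>M\<^esub> z = (x \<ominus>\<^bsub>M\<^esub> y) \<oplus>\<^bsub>M\<^esub> (y \<ominus>\<^bsub>M\<^esub> z)"
      using that(1-3) by (simp add: a_minus_def M.a_assoc M.r_neg1)
    then show ?thesis using NE(5) that by simp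
  qed
  have diff_sym: "y \<ominus>\<^bsub>M\<^esub> x \<in> N" if "x \<in> carrier M" "y \<in> carrier M" "x \<ominus>\<^bsub>M\<^esub> y \<in> N" for x y
  proof -
    have "y \<ominus>\<^bsub>M\<^esub> x = \<ominus>\<^bsub>M\<^esub> (x \<ominus>\<^bsub>M\<^esub> y)"
      using that(1,2) by (simp add: a_minus_def M.minus_add M.a_comm)
    then show ?thesis using NE(3) that by simp
  qed
  have rep_eq: "rep x = rep y \<longleftrightarrow> x \<ominus>\<^bsub>M\<^esub> y \<in> N" if "x \<in> carrier M" "y \<in> carrier M" for x y
  proof
    assume "rep x = rep y"
    then show "x \<ominus>\<^bsub>M\<^esub> y \<in> N"
      using diff_trans[of x "rep x" y] diff_sym[of y "rep x"] rep[of x] rep[of y] that by metis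
  next
    assume "x \<ominus>\<^bsub>M\<^esub> y \<in> N"
    then have "z \<in> carrier M \<and> x \<ominus>\<^bsub>M\<^esub> z \<in> N \<longleftrightarrow> z \<in> carrier M \<and> y \<ominus>\<^bsub>M\<^esub> z \<in> N" for z
      using that diff_trans diff_sym by blast
    then show "rep x = rep y" by (simp add: rep_def)
  qed
  have rep_add: "rep (rep x \<oplus>\<^bsub>M\<^esub> rep y) = rep (x \<oplus>\<^bsub>M\<^esub> y)"
    if c: "x \<in> carrier M" "y \<in> carrier M" for x y
  proof -
    have "(x \<oplus>\<^bsub>M\<^esub> y) \<ominus>\<^bsub>M\<^esub> (rep x \<oplus>\<^bsub>M\<^esub> rep y) = (x \<ominus>\<^bsub>M\<^esub> rep x) \<oplus>\<^bsub>M\<^esub> (y \<ominus>\<^bsub>M\<^esub> rep y)"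
      using c rep[of x] rep[of y] by (simp add: a_minus_def M.minus_add M.a_ac)
    then show ?thesis
      using NE(5) rep c rep_eq[of "x \<oplus>\<^bsub>M\<^esub> y" "rep x \<oplus>\<^bsub>M\<^esub> rep y"] by simp
  qed
  have rep_smult: "rep (r \<odot>\<^bsub>M\<^esub> rep x) = rep (r \<odot>\<^bsub>M\<^esub> x)"
    if c: "r \<in> carrier R" "x \<in> carrier M" for r x
  proof -
    have "(r \<odot>\<^bsub>M\<^esub> x) \<ominus>\<^bsub>M\<^esub> (r \<odot>\<^bsub>M\<^esub> rep x) = r \<odot>\<^bsub>M\<^esub> (x \<ominus>\<^bsub>M\<^esub> rep x)"
      using c rep[of x] by (simp add: a_minus_def smult_r_distr smult_r_minus)
    then show ?thesis
      using NE(4) rep c rep_eq[of "r \<odot>\<^bsub>M\<^esub> x" "r \<odot>\<^bsub>M\<^esub> rep x"] by simp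
  qed
  define Q :: "('a, 'b) module" where
    "Q = M\<lparr>carrier := rep ` carrier M, zero := rep \<zero>\<^bsub>M\<^esub>,
      add := (\<lambda>x y. rep (x \<oplus>\<^bsub>M\<^esub> y)), smult := (\<lambda>r x. rep (r \<odot>\<^bsub>M\<^esub> x))\<rparr>"
  have Qsimps: "carrier Q = rep ` carrier M" "\<zero>\<^bsub>Q\<^esub> = rep \<zero>\<^bsub>M\<^esub>" "add Q = (\<lambda>x y. rep (x \<oplus>\<^bsub>M\<^esub> y))"
    "smult Q = (\<lambda>r x. rep (r \<odot>\<^bsub>M\<^esub> x))"
    by (simp_all add: Q_def)
  have "module R Q"
    by (rule module_surjective_image[OF M, of rep]) (simp_all add: Qsimps rep_add rep_smult)
  moreover have "rep \<in> module_hom R M Q"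
    by (auto simp: module_hom_def hom_def Qsimps rep_add rep_smult)
  moreover have "rep ` carrier M = carrier Q"
    by (simp add: Qsimps)
  moreover have "a_kernel M Q rep = N"
  proof -
    have "x \<ominus>\<^bsub>M\<^esub> \<zero>\<^bsub>M\<^esub> = x" if "x \<in> carrier M" for x
      using that M.add.inv_one by (simp add: a_minus_def a_inv_def)
    then show ?thesis
      using NE(1) rep_eq[OF _ M.zero_closed] by (auto simp: a_kernel_def' Qsimps)
  qed
  ultimately show ?thesis by blast
qed

definition ann :: "('a, 'b) module \<Rightarrow> 'a set \<Rightarrow> 'b set" where
  "ann M I = {m \<in> carrier M. \<forall>r\<in>I. r \<odot>\<^bsub>M\<^esub> m = \<zero>\<^bsub>M\<^esub>}"

lemma annihilated_submodule_ann: "annihilated_submodule I M = M\<lparr>carrier := ann M I\<rparr>"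
  by (simp add: annihilated_submodule_def ann_def)

lemma torsion_part_ann: "torsion_part R \<aa> M = (\<Union>k\<in>{1..}. ann M (\<aa> [^]\<^bsub>ideals_set R\<^esub> (k::nat)))"
  by (auto simp: torsion_part_def ann_def)

lemma ann_antimono: "I \<subseteq> J \<Longrightarrow> ann M J \<subseteq> ann M I"
  by (auto simp: ann_def)

lemma ann_sub: "ann M I \<subseteq> carrier M"
  by (auto simp: ann_def)

text \<open>
  With \<open>N\<close> the zero submodule this is \<open>ann M I\<close>; with \<open>N\<close> the torsion part it is the preimage in
  \<open>M\<close> of the submodule of \<open>M / N\<close> annihilated by \<open>I\<close>.
\<close>

lemma transporter_submodule:
  assumes "module R M" "submodule N R M" "I \<subseteq> carrier R"
  shows "submodule {m \<in> carrier M. \<forall>r\<in>I. r \<odot>\<^bsub>M\<^esub> m \<in> N} R M"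
proof -
  interpret module R M by fact
  note NE = submoduleE[OF assms(2)]
  note N0 = submodule_zero[OF assms(2)]
  have comm: "r \<odot>\<^bsub>M\<^esub> (s \<odot>\<^bsub>M\<^esub> x) = s \<odot>\<^bsub>M\<^esub> (r \<odot>\<^bsub>M\<^esub> x)"
    if "r \<in> carrier R" "s \<in> carrier R" "x \<in> carrier M" for r s x
    using that by (metis smult_assoc1 R.m_comm)
  show ?thesis
    by (rule submoduleI)
      (use assms(3) NE N0 in \<open>auto simp: subset_iff smult_r_minus smult_r_distr comm\<close>)
qed

lemma ann_submodule:
  assumes "module R M" "I \<subseteq> carrier R"
  shows "submodule (ann M I) R M"
proof -
  interpret module R M by fact
  have "submodule {\<zero>\<^bsub>M\<^esub>} R M" by (rule submoduleI) auto
  from transporter_submodule[OF assms(1) this assms(2)] show ?thesis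
    by (simp add: ann_def)
qed

lemma ann_ideal_prod:
  assumes "module R M" "ideal I R" "ideal J R"
  shows "ann M (I \<cdot>\<^bsub>R\<^esub> J) = {m \<in> carrier M. \<forall>s\<in>J. s \<odot>\<^bsub>M\<^esub> m \<in> ann M I}"
proof -
  interpret module R M by fact
  have c: "I \<subseteq> carrier R" "J \<subseteq> carrier R" "I \<cdot>\<^bsub>R\<^esub> J \<subseteq> carrier R"
    using ideal.Icarr[OF assms(2)] ideal.Icarr[OF assms(3)] ideal_prod_in_carrier[OF assms(2,3)] by auto
  have 1: "x \<odot>\<^bsub>M\<^esub> m = \<zero>\<^bsub>M\<^esub>"
    if m: "m \<in> carrier M" "\<forall>s\<in>J. \<forall>r\<in>I. r \<odot>\<^bsub>M\<^esub> (s \<odot>\<^bsub>M\<^esub> m) = \<zero>\<^bsub>M\<^esub>" and "x \<in> I \<cdot>\<^bsub>R\<^esub> J" for x m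
    using that(3)
  proof induct
    case (prod r s)
    then show ?case using m c by (metis smult_assoc1 subsetD)
  next
    case (sum r s)
    then have "r \<in> carrier R" "s \<in> carrier R" using c by auto
    then show ?case using sum m by (simp add: smult_l_distr)
  qed
  have 2: "r \<odot>\<^bsub>M\<^esub> (s \<odot>\<^bsub>M\<^esub> m) = \<zero>\<^bsub>M\<^esub>" if "m \<in> ann M (I \<cdot>\<^bsub>R\<^esub> J)" "r \<in> I" "s \<in> J" for r s m
  proof -
    have "r \<otimes>\<^bsub>R\<^esub> s \<in> I \<cdot>\<^bsub>R\<^esub> J" "r \<in> carrier R" "s \<in> carrier R" "m \<in> carrier M"
      using that c by (auto simp: ann_def intro: ideal_prod.prod)
    then show ?thesis using that(1) smult_assoc1[of r s m] by (simp add: ann_def)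
  qed
  show ?thesis
  proof (intro subset_antisym subsetI)
    fix m assume m: "m \<in> ann M (I \<cdot>\<^bsub>R\<^esub> J)"
    then have "m \<in> carrier M" by (simp add: ann_def)
    then show "m \<in> {m \<in> carrier M. \<forall>s\<in>J. s \<odot>\<^bsub>M\<^esub> m \<in> ann M I}"
      using 2[OF m] c(2) by (auto simp: ann_def)
  next
    fix m assume "m \<in> {m \<in> carrier M. \<forall>s\<in>J. s \<odot>\<^bsub>M\<^esub> m \<in> ann M I}"
    then show "m \<in> ann M (I \<cdot>\<^bsub>R\<^esub> J)"
      using 1[of m] by (simp add: ann_def)
  qed
qed

text \<open>
  The elements of \<open>R\<close> that kill a given \<open>m\<close> form an ideal; if it contains \<open>A\<close>, it contains the
  ideal generated by \<open>A\<close>.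
\<close>

lemma ann_genideal:
  assumes "module R M" "A \<subseteq> carrier R"
  shows "ann M (genideal R A) = ann M A"
proof
  interpret module R M by fact
  show "ann M (genideal R A) \<subseteq> ann M A"
    by (rule ann_antimono) (rule genideal_self[OF assms(2)])
  show "ann M A \<subseteq> ann M (genideal R A)"
  proof
    fix m assume m: "m \<in> ann M A"
    then have mc: "m \<in> carrier M" by (simp add: ann_def)
    have "ideal {r \<in> carrier R. r \<odot>\<^bsub>M\<^esub> m = \<zero>\<^bsub>M\<^esub>} R"
    proof (rule idealI[OF R.ring_axioms])
      show "subgroup {r \<in> carrier R. r \<odot>\<^bsub>M\<^esub> m = \<zero>\<^bsub>M\<^esub>} (add_monoid R)"
        using mc by unfold_locales
          (auto simp: smult_l_distr smult_l_minus a_inv_def[symmetric])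
    next
      fix r s assume r: "r \<in> {r \<in> carrier R. r \<odot>\<^bsub>M\<^esub> m = \<zero>\<^bsub>M\<^esub>}" and s: "s \<in> carrier R"
      then show "s \<otimes>\<^bsub>R\<^esub> r \<in> {r \<in> carrier R. r \<odot>\<^bsub>M\<^esub> m = \<zero>\<^bsub>M\<^esub>}"
        using mc by (simp add: smult_assoc1)
      then show "r \<otimes>\<^bsub>R\<^esub> s \<in> {r \<in> carrier R. r \<odot>\<^bsub>M\<^esub> m = \<zero>\<^bsub>M\<^esub>}"
        using r s by (simp add: R.m_comm)
    qed
    then have "genideal R A \<subseteq> {r \<in> carrier R. r \<odot>\<^bsub>M\<^esub> m = \<zero>\<^bsub>M\<^esub>}"
      by (rule genideal_minimal) (use m assms(2) in \<open>auto simp: ann_def\<close>)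
    then show "m \<in> ann M (genideal R A)"
      using mc by (auto simp: ann_def)
  qed
qed

text \<open>
  The torsion part is the union of an increasing chain of submodules, because the powers of \<open>I\<close>
  decrease.
\<close>

lemma torsion_part_submodule:
  assumes "module R M" "ideal I R"
  shows "submodule (torsion_part R I M) R M"
proof -
  interpret module R M by fact
  have sm: "submodule (ann M (I [^]\<^bsub>ideals_set R\<^esub> k)) R M" for k :: nat
    by (rule ann_submodule[OF assms(1) ideal_pow_carrier[OF assms(2)]])
  have mono: "ann M (I [^]\<^bsub>ideals_set R\<^esub> j) \<subseteq> ann M (I [^]\<^bsub>ideals_set R\<^esub> k)" if "j \<le> k" for j k :: nat
    by (rule ann_antimono[OF ideal_pow_antimono[OF assms(2) that]])
  show ?thesis
  proof (rule submoduleI)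
    show "torsion_part R I M \<subseteq> carrier M" by (auto simp: torsion_part_def)
    show "\<zero>\<^bsub>M\<^esub> \<in> torsion_part R I M"
      using ideal_pow_carrier[OF assms(2), of 1] by (auto simp: torsion_part_def subset_iff intro!: exI[of _ 1])
    show "\<ominus>\<^bsub>M\<^esub> x \<in> torsion_part R I M" if "x \<in> torsion_part R I M" for x
      using that submoduleE(3)[OF sm] unfolding torsion_part_ann by blast
    show "r \<odot>\<^bsub>M\<^esub> x \<in> torsion_part R I M" if "r \<in> carrier R" "x \<in> torsion_part R I M" for r x
      using that submoduleE(4)[OF sm] unfolding torsion_part_ann by blast
    fix x y assume "x \<in> torsion_part R I M" "y \<in> torsion_part R I M"
    then obtain j k :: nat where jk: "j \<ge> 1" "k \<ge> 1"
      "x \<in> ann M (I [^]\<^bsub>ideals_set R\<^esub> j)" "y \<in> ann M (I [^]\<^bsub>ideals_set R\<^esub> k)"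
      unfolding torsion_part_ann by auto
    then have "x \<oplus>\<^bsub>M\<^esub> y \<in> ann M (I [^]\<^bsub>ideals_set R\<^esub> (max j k))"
      using mono[of j "max j k"] mono[of k "max j k"] by (intro submoduleE(5)[OF sm]) auto
    moreover have "max j k \<in> {1..}" using jk by auto
    ultimately show "x \<oplus>\<^bsub>M\<^esub> y \<in> torsion_part R I M"
      unfolding torsion_part_ann by blast
  qed
qed

section \<open>Serre classes\<close>

lemma serre_smaller_submodule:
  assumes "serre_subcategory R S" "module R M" "submodule K R M" "K \<subseteq> N" "M\<lparr>carrier := N\<rparr> \<in> S"
  shows "M\<lparr>carrier := K\<rparr> \<in> S"
proof -
  have "module R (M\<lparr>carrier := K\<rparr>)"
    using assms(2,3) by (simp add: submodule.submodule_is_module)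
  moreover have "(\<lambda>x. x) \<in> module_hom R (M\<lparr>carrier := K\<rparr>) (M\<lparr>carrier := N\<rparr>)"
    using assms(4) by (auto simp: module_hom_def hom_def)
  ultimately show ?thesis
    using assms(1,5) unfolding serre_subcategory_def closed_under_submodules_def
    by (metis inj_on_id2)
qed

lemma serre_image:
  assumes "serre_subcategory R S" "M \<in> S" "module R N" "g \<in> module_hom R M N" "g ` carrier M = carrier N"
  shows "N \<in> S"
  using assms unfolding serre_subcategory_def closed_under_quotients_def by blast

lemma serre_extension:
  assumes "serre_subcategory R S" "module R M" "g \<in> module_hom R M N" "g ` carrier M = carrier N"
    and "M\<lparr>carrier := a_kernel M N g\<rparr> \<in> S" "N \<in> S"
  shows "M \<in> S"
proof -
  have "short_exact R (M\<lparr>carrier := a_kernel M N g\<rparr>) (\<lambda>x. x) M g N"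
    using assms(3,4) by (auto simp: short_exact_def module_hom_def hom_def a_kernel_def')
  then show ?thesis
    using assms unfolding serre_subcategory_def closed_under_extensions_def by blast
qed

text \<open>
  Induction on \<open>A\<close>: for \<open>a \<in> A\<close>, multiplication by \<open>a\<close> makes \<open>L\<close> an extension of \<open>a L \<subseteq> N\<close> by the
  kernel \<open>{x \<in> L. a x = 0}\<close>, to which the induction hypothesis applies with one generator fewer.
\<close>

lemma serre_submodule_by_finite_multiplication:
  assumes S: "serre_subcategory R S" and M: "module R M" and N: "submodule N R M" "M\<lparr>carrier := N\<rparr> \<in> S"
    and "finite A" "A \<subseteq> carrier R" "submodule L R M"
    and "\<And>a x. a \<in> A \<Longrightarrow> x \<in> L \<Longrightarrow> a \<odot>\<^bsub>M\<^esub> x \<in> N"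
    and "M\<lparr>carrier := L \<inter> ann M A\<rparr> \<in> S"
  shows "M\<lparr>carrier := L\<rparr> \<in> S"
  using assms(5-)
proof (induct A arbitrary: L)
  case empty
  interpret module R M by fact
  have "L \<inter> ann M {} = L" using submoduleE(1)[OF empty(2)] by (auto simp: ann_def)
  with empty show ?case by simp
next
  case (insert a A)
  interpret module R M by fact
  note LE = submoduleE[OF insert(5)]
  have a: "a \<in> carrier R" using insert by auto
  let ?K = "L \<inter> ann M {a}"
  let ?L = "M\<lparr>carrier := L\<rparr>" and ?I = "M\<lparr>carrier := (\<lambda>x. a \<odot>\<^bsub>M\<^esub> x) ` L\<rparr>"
  have aK: "submodule (ann M {a}) R M" using a by (intro ann_submodule M) auto
  note L0 = submodule_zero[OF insert(5)]
  have subK: "submodule ?K R M"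
    using submoduleE[OF aK] LE L0 a by (intro submoduleI) (auto simp: ann_def)
  have eqK: "?K \<inter> ann M A = L \<inter> ann M (insert a A)" by (auto simp: ann_def)
  have K: "M\<lparr>carrier := ?K\<rparr> \<in> S"
  proof (rule insert(3)[OF _ subK])
    show "A \<subseteq> carrier R" using insert(4) by simp
    show "b \<odot>\<^bsub>M\<^esub> x \<in> N" if "b \<in> A" "x \<in> ?K" for b x
      using that insert(6) by simp
    show "M\<lparr>carrier := ?K \<inter> ann M A\<rparr> \<in> S" using insert(7) unfolding eqK .
  qed
  have I: "submodule ((\<lambda>x. a \<odot>\<^bsub>M\<^esub> x) ` L) R M"
  proof (rule submoduleI)
    have "r \<odot>\<^bsub>M\<^esub> (a \<odot>\<^bsub>M\<^esub> x) = a \<odot>\<^bsub>M\<^esub> (r \<odot>\<^bsub>M\<^esub> x)" if "r \<in> carrier R" "x \<in> L" for r x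
      using that LE(1) a by (metis smult_assoc1 R.m_comm subsetD)
    then show "r \<odot>\<^bsub>M\<^esub> y \<in> (\<lambda>x. a \<odot>\<^bsub>M\<^esub> x) ` L" if "r \<in> carrier R" "y \<in> (\<lambda>x. a \<odot>\<^bsub>M\<^esub> x) ` L" for r y
      using that LE(4) by auto
    show "\<zero>\<^bsub>M\<^esub> \<in> (\<lambda>x. a \<odot>\<^bsub>M\<^esub> x) ` L"
      using L0 a by (intro image_eqI[of _ _ "\<zero>\<^bsub>M\<^esub>"]) auto
    show "\<ominus>\<^bsub>M\<^esub> y \<in> (\<lambda>x. a \<odot>\<^bsub>M\<^esub> x) ` L" if "y \<in> (\<lambda>x. a \<odot>\<^bsub>M\<^esub> x) ` L" for y
      using that LE(1,3) a by (auto simp: subset_iff smult_r_minus[symmetric])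
    show "y \<oplus>\<^bsub>M\<^esub> z \<in> (\<lambda>x. a \<odot>\<^bsub>M\<^esub> x) ` L"
      if "y \<in> (\<lambda>x. a \<odot>\<^bsub>M\<^esub> x) ` L" "z \<in> (\<lambda>x. a \<odot>\<^bsub>M\<^esub> x) ` L" for y z
      using that LE(1,5) a by (auto simp: subset_iff smult_r_distr[symmetric])
  qed (use LE(1) a in auto)
  show ?case
  proof (rule serre_extension[OF S])
    show "module R ?L" using insert(5) M by (rule submodule.submodule_is_module)
    show "(\<lambda>x. a \<odot>\<^bsub>M\<^esub> x) \<in> module_hom R ?L ?I"
      using LE(1) a by (auto simp: module_hom_def hom_def smult_r_distr subset_iff)
        (metis smult_assoc1 R.m_comm)
    show "(\<lambda>x. a \<odot>\<^bsub>M\<^esub> x) ` carrier ?L = carrier ?I" by simp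
    have "a_kernel ?L ?I (\<lambda>x. a \<odot>\<^bsub>M\<^esub> x) = ?K"
      using LE(1) by (auto simp: a_kernel_def' ann_def)
    then show "?L\<lparr>carrier := a_kernel ?L ?I (\<lambda>x. a \<odot>\<^bsub>M\<^esub> x)\<rparr> \<in> S"
      using K by simp
    show "?I \<in> S"
      by (rule serre_smaller_submodule[OF S M I _ N(2)]) (use insert(6) in auto)
  qed
qed

lemma serre_submodule_by_multiplication:
  assumes S: "serre_subcategory R S" and M: "module R M" and N: "submodule N R M" "M\<lparr>carrier := N\<rparr> \<in> S"
    and R: "noetherian_ring R" and I: "ideal I R" and L: "submodule L R M"
    and IL: "\<And>a x. a \<in> I \<Longrightarrow> x \<in> L \<Longrightarrow> a \<odot>\<^bsub>M\<^esub> x \<in> N"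
    and "ann M I \<subseteq> L" "M\<lparr>carrier := ann M I\<rparr> \<in> S"
  shows "M\<lparr>carrier := L\<rparr> \<in> S"
proof -
  interpret module R M by fact
  obtain A where A: "A \<subseteq> carrier R" "finite A" "I = genideal R A"
    using noetherian_ring.finetely_gen[OF R I] by blast
  have "L \<inter> ann M A = ann M I"
    using assms(9) ann_genideal[OF M A(1)] A(3) by auto
  moreover have "A \<subseteq> I" using genideal_self[OF A(1)] A(3) by simp
  ultimately show ?thesis
    using serre_submodule_by_finite_multiplication[OF S M N A(2,1) L] IL assms(10) by auto
qed

section \<open>The condition for products of ideals\<close>

text \<open>
  A module that is torsion for the unit ideal equals its submodule annihilated by the unit ideal (both
  are zero).
\<close>

lemma C_condition_unit_ideal:
  fixes S :: "('a, 'b) module set"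
  shows "C_condition R (carrier R) S"
  unfolding C_condition_def
proof (intro allI impI)
  fix M :: "('a, 'b) module"
  assume M: "module R M" and t: "torsion_part R (carrier R) M = carrier M"
    and a: "annihilated_submodule (carrier R) M \<in> S"
  interpret module R M by fact
  have p: "carrier R [^]\<^bsub>ideals_set R\<^esub> k = carrier R" for k :: nat
    by (induct k) (auto simp: ideal_prod_one oneideal)
  have "carrier M = ann M (carrier R)"
    using t unfolding torsion_part_ann p by auto
  moreover have "M\<lparr>carrier := carrier M\<rparr> = M" by simp
  ultimately show "M \<in> S" using a by (simp only: annihilated_submodule_ann)
qed

text \<open>
  The condition for \<open>I\<close> is used on the \<open>I\<close>-torsion part \<open>N\<close> of \<open>M\<close>, and the condition for \<open>J\<close> on
  \<open>M / N\<close>.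
\<close>

lemma C_condition_ideal_prod:
  fixes S :: "('a, 'b) module set"
  assumes R: "noetherian_ring R" and S: "serre_subcategory R S"
    and I: "ideal I R" and J: "ideal J R"
    and CI: "C_condition R I S" and CJ: "C_condition R J S"
  shows "C_condition R (I \<cdot>\<^bsub>R\<^esub> J) S"
  unfolding C_condition_def
proof (intro allI impI)
  fix M :: "('a, 'b) module"
  assume M: "module R M" and t: "torsion_part R (I \<cdot>\<^bsub>R\<^esub> J) M = carrier M"
    and "annihilated_submodule (I \<cdot>\<^bsub>R\<^esub> J) M \<in> S"
  then have aS: "M\<lparr>carrier := ann M (I \<cdot>\<^bsub>R\<^esub> J)\<rparr> \<in> S" by (simp add: annihilated_submodule_ann)
  interpret module R M by fact
  have IR: "I \<subseteq> carrier R" and JR: "J \<subseteq> carrier R"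
    using ideal.Icarr[OF I] ideal.Icarr[OF J] by blast+
  have annI: "M\<lparr>carrier := ann M I\<rparr> \<in> S" and annJ: "M\<lparr>carrier := ann M J\<rparr> \<in> S"
    using serre_smaller_submodule[OF S M ann_submodule[OF M IR] ann_antimono aS]
      serre_smaller_submodule[OF S M ann_submodule[OF M JR] ann_antimono aS] ideal_prod_inter[OF I J]
    by simp_all
  define N where "N = torsion_part R I M"
  have N: "submodule N R M" unfolding N_def by (rule torsion_part_submodule[OF M I])
  note NE = submoduleE[OF N]
  have "ann M (I [^]\<^bsub>ideals_set R\<^esub> (1::nat)) \<subseteq> N"
    unfolding N_def torsion_part_ann by (rule UN_upper) simp
  then have annIN: "ann M I \<subseteq> N"
    unfolding ideal_pow_1[OF I] .
  have NS: "M\<lparr>carrier := N\<rparr> \<in> S"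
  proof -
    have "torsion_part R I (M\<lparr>carrier := N\<rparr>) = N"
      by (auto simp: N_def torsion_part_def)
    moreover have "annihilated_submodule I (M\<lparr>carrier := N\<rparr>) = M\<lparr>carrier := ann M I\<rparr>"
      using annIN NE(1) by (auto simp: annihilated_submodule_def ann_def intro!: arg_cong[of _ _ "\<lambda>A. M\<lparr>carrier := A\<rparr>"])
    ultimately show ?thesis
      using CI annI submodule.submodule_is_module[OF N M] by (simp add: C_condition_def)
  qed
  \<comment> \<open>The preimage in \<open>M\<close> of the part of \<open>M / N\<close> annihilated by \<open>J\<close>.\<close>
  define L where "L = {m \<in> carrier M. \<forall>s\<in>J. s \<odot>\<^bsub>M\<^esub> m \<in> N}"
  have L: "submodule L R M" unfolding L_def by (rule transporter_submodule[OF M N JR])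
  note N0 = submodule_zero[OF N]
  have "ann M J \<subseteq> L"
    using N0 by (auto simp: ann_def L_def)
  then have LS: "M\<lparr>carrier := L\<rparr> \<in> S"
    by (intro serre_submodule_by_multiplication[OF S M N NS R J L _ _ annJ]) (auto simp: L_def)
  obtain Q :: "('a, 'b) module" and g where Q: "module R Q" and g: "g \<in> module_hom R M Q"
    and gim: "g ` carrier M = carrier Q" and ker: "a_kernel M Q g = N"
    using exists_quotient[OF M N] by blast
  have g0: "g m = \<zero>\<^bsub>Q\<^esub> \<longleftrightarrow> m \<in> N" if "m \<in> carrier M" for m
    using ker that by (auto simp: a_kernel_def')
  have annQ: "g m \<in> ann Q K \<longleftrightarrow> (\<forall>s\<in>K. s \<odot>\<^bsub>M\<^esub> m \<in> N)" if "m \<in> carrier M" "K \<subseteq> carrier R" for m K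
  proof -
    have "s \<odot>\<^bsub>Q\<^esub> g m = \<zero>\<^bsub>Q\<^esub> \<longleftrightarrow> s \<odot>\<^bsub>M\<^esub> m \<in> N" if "s \<in> K" for s
    proof -
      have "s \<in> carrier R" using that \<open>K \<subseteq> carrier R\<close> by blast
      then show ?thesis
        using g0[of "s \<odot>\<^bsub>M\<^esub> m"] module_hom_smult[OF g, of s m] \<open>m \<in> carrier M\<close> by simp
    qed
    moreover have "g m \<in> carrier Q" using that(1) gim by blast
    ultimately show ?thesis by (simp add: ann_def)
  qed
  have "torsion_part R J Q = carrier Q"
  proof
    show "torsion_part R J Q \<subseteq> carrier Q" by (auto simp: torsion_part_def)
    show "carrier Q \<subseteq> torsion_part R J Q"
    proof
      fix y assume "y \<in> carrier Q"
      then obtain m where m: "m \<in> carrier M" "y = g m" using gim by auto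
      then obtain k :: nat where k: "k \<ge> 1" "m \<in> ann M ((I \<cdot>\<^bsub>R\<^esub> J) [^]\<^bsub>ideals_set R\<^esub> k)"
        using t unfolding torsion_part_ann by auto
      have "\<forall>s\<in>J [^]\<^bsub>ideals_set R\<^esub> k. s \<odot>\<^bsub>M\<^esub> m \<in> N"
        using k unfolding ideal_prod_pow[OF I J] ann_ideal_prod[OF M ideal_pow_ideal ideal_pow_ideal, OF I J]
        by (auto simp: N_def torsion_part_ann)
      moreover have "J [^]\<^bsub>ideals_set R\<^esub> k \<subseteq> carrier R"
        by (rule ideal_pow_carrier[OF J])
      ultimately have "y \<in> ann Q (J [^]\<^bsub>ideals_set R\<^esub> k)"
        using annQ m by blast
      then show "y \<in> torsion_part R J Q"
        using k(1) unfolding torsion_part_ann by auto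
    qed
  qed
  moreover have "annihilated_submodule J Q \<in> S"
  proof (rule serre_image[OF S LS, of _ g])
    show "module R (annihilated_submodule J Q)"
      unfolding annihilated_submodule_ann
      by (rule submodule.submodule_is_module[OF ann_submodule[OF Q JR] Q])
    show im: "g ` carrier (M\<lparr>carrier := L\<rparr>) = carrier (annihilated_submodule J Q)"
    proof -
      have "L = {m \<in> carrier M. g m \<in> ann Q J}"
        unfolding L_def using annQ[OF _ JR] by blast
      then have "g ` L = ann Q J"
        using gim ann_sub[of Q J] by auto
      then show ?thesis by (simp add: annihilated_submodule_ann)
    qed
    show "g \<in> module_hom R (M\<lparr>carrier := L\<rparr>) (annihilated_submodule J Q)"
    proof -
      have "g x \<in> carrier (annihilated_submodule J Q)" if "x \<in> L" for x
        using im that by auto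
      moreover have "x \<in> carrier M" if "x \<in> L" for x
        using submoduleE(1)[OF L] that by blast
      ultimately show ?thesis
        using module_hom_add[OF g] module_hom_smult[OF g]
        by (simp add: module_hom_def hom_def Pi_iff annihilated_submodule_ann)
    qed
  qed
  ultimately have "Q \<in> S"
    using CJ Q unfolding C_condition_def by blast
  then show "M \<in> S"
    using NS by (intro serre_extension[OF S M g gim]) (simp_all add: ker)
qed

text \<open>
  \<open>I\<close>-torsion implies \<open>J\<close>-torsion as \<open>J \<subseteq> I\<close>. To apply the condition for \<open>J\<close>, climb from \<open>(0 : I)\<close>
  to \<open>(0 : I\<^sup>n)\<close>, which contains \<open>(0 : J)\<close>, one power at a time.
\<close>

lemma C_condition_larger_ideal:
  fixes S :: "('a, 'b) module set"
  assumes R: "noetherian_ring R" and S: "serre_subcategory R S"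
    and I: "ideal I R" and J: "ideal J R" and "J \<subseteq> I" and pow: "I [^]\<^bsub>ideals_set R\<^esub> (n::nat) \<subseteq> J"
    and CJ: "C_condition R J S"
  shows "C_condition R I S"
  unfolding C_condition_def
proof (intro allI impI)
  fix M :: "('a, 'b) module"
  assume M: "module R M" and t: "torsion_part R I M = carrier M"
    and "annihilated_submodule I M \<in> S"
  then have aS: "M\<lparr>carrier := ann M I\<rparr> \<in> S" by (simp add: annihilated_submodule_ann)
  interpret module R M by fact
  have pc: "I [^]\<^bsub>ideals_set R\<^esub> k \<subseteq> carrier R" for k :: nat
    by (rule ideal_pow_carrier[OF I])
  have annS: "M\<lparr>carrier := ann M (I [^]\<^bsub>ideals_set R\<^esub> k)\<rparr> \<in> S" for k :: nat
  proof (induct k)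
    case 0
    have "I \<subseteq> carrier R" using ideal.Icarr[OF I] by blast
    then show ?case
      unfolding ideal_pow_0
      by (intro serre_smaller_submodule[OF S M _ _ aS] ann_submodule[OF M] ann_antimono) auto
  next
    case (Suc k)
    have eq: "ann M (I [^]\<^bsub>ideals_set R\<^esub> Suc k) =
        {m \<in> carrier M. \<forall>s\<in>I. s \<odot>\<^bsub>M\<^esub> m \<in> ann M (I [^]\<^bsub>ideals_set R\<^esub> k)}"
      unfolding ideal_pow_Suc by (rule ann_ideal_prod[OF M ideal_pow_ideal[OF I] I])
    have "I [^]\<^bsub>ideals_set R\<^esub> Suc k \<subseteq> I"
      using ideal_prod_inter[OF ideal_pow_ideal[OF I] I] by simp
    then have "ann M I \<subseteq> ann M (I [^]\<^bsub>ideals_set R\<^esub> Suc k)" by (rule ann_antimono)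
    then show ?case
      by (intro serre_submodule_by_multiplication[OF S M ann_submodule[OF M pc] Suc R I
            ann_submodule[OF M pc] _ _ aS]) (use eq in auto)
  qed
  have "J \<subseteq> carrier R" using ideal.Icarr[OF J] by blast
  then have "annihilated_submodule J M \<in> S"
    unfolding annihilated_submodule_ann
    by (intro serre_smaller_submodule[OF S M _ _ annS[of n]] ann_submodule[OF M] ann_antimono pow)
  moreover have "torsion_part R J M = carrier M"
  proof
    show "torsion_part R J M \<subseteq> carrier M" by (auto simp: torsion_part_def)
    show "carrier M \<subseteq> torsion_part R J M"
      unfolding t[symmetric] torsion_part_ann
      by (intro UN_mono subset_refl ann_antimono ideal_pow_mono[OF \<open>J \<subseteq> I\<close>])
  qed
  ultimately show "M \<in> S"
    using CJ M unfolding C_condition_def by blast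
qed

theorem corollary2p9:
  fixes R :: "('a, 'm) ring_scheme"
    and \<aa> :: "'a set"
    and S :: "('a, 'b) module set"
  assumes "cring R" and "noetherian_ring R"
    and "ideal \<aa> R"
    and "serre_subcategory R S"
    and "\<And>\<pp>. minimal_prime_over R \<aa> \<pp> \<Longrightarrow> C_condition R \<pp> S"
  shows "C_condition R \<aa> S"
proof -
  interpret cring R by fact
  define P where "P = {\<pp>. minimal_prime_over R \<aa> \<pp>}"
  have P: "ideal \<pp> R" "\<aa> \<subseteq> \<pp>" "C_condition R \<pp> S" if "\<pp> \<in> P" for \<pp>
    using that assms(5) by (auto simp: P_def minimal_prime_over_def primeideal_def)
  obtain b where b: "b \<in> ideal_products R P" "b \<subseteq> \<aa>"
    using exists_minimal_prime_product_subset[OF assms(1-3)] by (auto simp: P_def)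
  have "C_condition R b S"
    using b(1)
  proof induct
    case one
    show ?case by (rule C_condition_unit_ideal)
  next
    case (factor I)
    then show ?case by (rule P)
  next
    case (mult I J)
    then show ?case
      using ideal_products_ideal[OF _ P(1)] by (blast intro: C_condition_ideal_prod assms)
  qed
  moreover obtain k :: nat where "\<aa> [^]\<^bsub>ideals_set R\<^esub> k \<subseteq> b"
    using pow_subset_ideal_product[OF assms(3) b(1) P(2)] by blast
  ultimately show ?thesis
    using C_condition_larger_ideal[OF assms(2,4,3) _ b(2)] ideal_products_ideal[OF b(1) P(1)] by blast
qed

end
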